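(* Assume that (A1)–(A3), as written out in the context, hold. For any $u_0>0$ there exist $\delta>0$, positive stochastic matrices $(\Psi_k(s):s\ge0)$ with identical rows, and stochastic matrices $(\mathscr A_k(s):s\ge0)$, $k\in\mathbb Z_+$, such that $$P(s,s+ku_0)=\big(1-(1-\delta)^k\big)\Psi_k(s)+(1-\delta)^k\mathscr A_k(s)$$ for all $s\ge0$ and $k\in\mathbb Z_+$.
   Context: $S$ is a finite set, $|S|=d<\infty$, and $Q(t)=(Q(t,x,y):x,y\in S)$, $t\ge0$, are rate matrices (nonnegative off-diagonal entries, rows summing to $0$) of a Markov jump process $X$ on $S$. Matrices are indexed by $S\times S$; a matrix is positive if all its entries are strictly positive. (A1) For $x,y\in S$, $Q(\cdot,x,y)$ is measurable. (In the paper (A1) also requires measurability in $t$ of reward-related functions that play no role in this statement.) (A2) $\mathcal B=\{(x,y):Q(t,x,y)>0\}$ does not depend on $t$, and $Q(1)$ (hence every $Q(t)$) is an irreducible rate matrix. (A3) For each $(x,y)\in\mathcal B$, $0<\inf_{t\ge0}Q(t,x,y)\le\sup_{t\ge0}Q(t,x,y)<\infty$. Under these assumptions $(P(s,t):0\le s\le t<\infty)$ denotes the unique family of stochastic matrices (the transition matrices of $X$) satisfying the Kolmogorov backward and forward equations $$P(t-s,t)=I+\int_0^sQ(t-u)P(t-u,t)\,du\quad(0\le s\le t),\qquad P(t,t+s)=I+\int_0^sP(t,t+u)Q(t+u)\,du\quad(s\ge0).$$ *)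

theory Defs
  imports "HOL-Analysis.Analysis"
begin

definition rate_matrix :: "real ^ 's ^ 's \<Rightarrow> bool" where
  "rate_matrix M \<longleftrightarrow>
    (\<forall>x y. x \<noteq> y \<longrightarrow> 0 \<le> M $ x $ y) \<and> (\<forall>x. (\<Sum>y\<in>UNIV. M $ x $ y) = 0)"

definition stochastic_matrix :: "real ^ 's ^ 's \<Rightarrow> bool" where
  "stochastic_matrix M \<longleftrightarrow>
    (\<forall>x y. 0 \<le> M $ x $ y) \<and> (\<forall>x. (\<Sum>y\<in>UNIV. M $ x $ y) = 1)"

definition positive_matrix :: "real ^ 's ^ 's \<Rightarrow> bool" where
  "positive_matrix M \<longleftrightarrow> (\<forall>x y. 0 < M $ x $ y)"

definition identical_rows :: "real ^ 's ^ 's \<Rightarrow> bool" where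
  "identical_rows M \<longleftrightarrow> (\<forall>x y. row x M = row y M)"

text \<open>For a rate matrix the diagonal is nonpositive, so only transitions between distinct
  states belong to this set.\<close>

definition transitions :: "real ^ 's ^ 's \<Rightarrow> ('s \<times> 's) set" where
  "transitions M = {(x, y). 0 < M $ x $ y}"

text \<open>Every state is reachable from every other one. The closure is reflexive, so the zero
  rate matrix on a one-point state space is irreducible.\<close>

definition irreducible_rate_matrix :: "real ^ 's ^ 's \<Rightarrow> bool" where
  "irreducible_rate_matrix M \<longleftrightarrow>
    rate_matrix M \<and> (\<forall>x y. (x, y) \<in> (transitions M)\<^sup>*)"

definition measurable_rates :: "(real \<Rightarrow> real ^ 's ^ 's) \<Rightarrow> bool" where
  "measurable_rates Q \<longleftrightarrow>
    (\<forall>x y. (\<lambda>t. Q t $ x $ y) \<in> borel_measurable (restrict_space borel {0..}))"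

definition constant_irreducible_structure :: "(real \<Rightarrow> real ^ 's ^ 's) \<Rightarrow> bool" where
  "constant_irreducible_structure Q \<longleftrightarrow>
    (\<forall>t\<ge>0. transitions (Q t) = transitions (Q 1)) \<and> irreducible_rate_matrix (Q 1)"

text \<open>The set of transitions is meant to be independent of time, hence is read off at time 1.
  The supremum is finite exactly when the rates are bounded above; the infimum is over
  a set of positive reals as soon as the transitions are indeed independent of time.\<close>

definition bounded_rates :: "(real \<Rightarrow> real ^ 's ^ 's) \<Rightarrow> bool" where
  "bounded_rates Q \<longleftrightarrow>
    (\<forall>(x, y) \<in> transitions (Q 1).
       0 < (INF t\<in>{0..}. Q t $ x $ y) \<and> bdd_above ((\<lambda>t. Q t $ x $ y) ` {0..}))"

text \<open>Integrability is required explicitly, because the Bochner integral of a non-integrable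
  function is 0 by convention. The integrals are matrix-valued, hence entrywise.\<close>

definition kolmogorov_backward ::
  "(real \<Rightarrow> real ^ 's ^ 's) \<Rightarrow> (real \<Rightarrow> real \<Rightarrow> real ^ 's ^ 's) \<Rightarrow> bool" where
  "kolmogorov_backward Q P \<longleftrightarrow>
    (\<forall>s t. 0 \<le> s \<and> s \<le> t \<longrightarrow>
       set_integrable lborel {0..s} (\<lambda>u. Q (t - u) ** P (t - u) t) \<and>
       P (t - s) t = mat 1 + (LINT u:{0..s}|lborel. Q (t - u) ** P (t - u) t))"

definition kolmogorov_forward ::
  "(real \<Rightarrow> real ^ 's ^ 's) \<Rightarrow> (real \<Rightarrow> real \<Rightarrow> real ^ 's ^ 's) \<Rightarrow> bool" where
  "kolmogorov_forward Q P \<longleftrightarrow>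
    (\<forall>s t. 0 \<le> s \<and> 0 \<le> t \<longrightarrow>
       set_integrable lborel {0..s} (\<lambda>u. P t (t + u) ** Q (t + u)) \<and>
       P t (t + s) = mat 1 + (LINT u:{0..s}|lborel. P t (t + u) ** Q (t + u)))"

text \<open>Only the values \<open>P s t\<close> with \<open>0 \<le> s \<le> t\<close> are constrained, and these are determined
  by \<open>Q\<close> under the assumptions above.\<close>

definition transition_matrices ::
  "(real \<Rightarrow> real ^ 's ^ 's) \<Rightarrow> (real \<Rightarrow> real \<Rightarrow> real ^ 's ^ 's) \<Rightarrow> bool" where
  "transition_matrices Q P \<longleftrightarrow>
    (\<forall>s t. 0 \<le> s \<and> s \<le> t \<longrightarrow> stochastic_matrix (P s t)) \<and>
    kolmogorov_backward Q P \<and> kolmogorov_forward Q P"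

end

theory Submission
  imports Defs
begin

text \<open>On a short time interval every diagonal entry of \<open>P\<close> stays above \<open>1/2\<close>, and by the
  forward equation every entry in \<open>\<B>\<close> grows at least linearly, uniformly in the starting
  time. Composing \<open>n\<close> such steps along paths of length \<open>n\<close> bounds all entries of
  \<open>P s (s + u0)\<close> below by some \<open>\<epsilon> > 0\<close>, so that \<open>P s (s + u0)\<close> is a mixture, with weights
  \<open>\<delta>\<close> and \<open>1 - \<delta>\<close>, of the uniform matrix and a stochastic matrix. Mixtures of this
  kind compose: \<open>((1-r)\<Psi> + rA)((1-q)\<Phi> + qB) = (1-r)\<Psi>N + r(1-q)\<Phi> + rqAB\<close>, where
  \<open>N = (1-q)\<Phi> + qB\<close> and \<open>A\<Phi> = \<Phi>\<close> because \<open>\<Phi>\<close> has identical rows. The Chapman--Kolmogorov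
  equation comes from uniqueness for the forward equation: a bounded solution of
  \<open>D v = \<integral>\<^sub>0\<^sup>v D u R u du\<close> satisfies \<open>\<bar>D v\<bar> \<le> (Cv)^n / n!\<close> for all \<open>n\<close>.\<close>

section \<open>Stochastic matrices\<close>

lemma matrix_mult_nth: "(M ** N) $ x $ y = (\<Sum>z\<in>UNIV. M $ x $ z * N $ z $ y)"
  for M N :: "real ^ 's::finite ^ 's"
  by (simp add: matrix_matrix_mult_def)

lemma matrix_add_rdistrib: "(A + B) ** C = A ** C + B ** C"
  for A B C :: "real ^ 's::finite ^ 's"
  by (simp add: vec_eq_iff matrix_mult_nth distrib_right sum.distrib)

lemma matrix_diff_rdistrib: "(A - B) ** C = A ** C - B ** C"
  for A B C :: "real ^ 's::finite ^ 's"
  by (simp add: vec_eq_iff matrix_mult_nth left_diff_distrib sum_subtractf)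

lemma matrix_diff_ldistrib: "A ** (B - C) = A ** B - A ** C"
  for A B C :: "real ^ 's::finite ^ 's"
  by (simp add: vec_eq_iff matrix_mult_nth right_diff_distrib sum_subtractf)

lemma stochastic_matrix_entry:
  fixes M :: "real ^ 's::finite ^ 's"
  assumes "stochastic_matrix M"
  shows "0 \<le> M $ x $ y" "M $ x $ y \<le> 1"
proof -
  show nonneg: "0 \<le> M $ x $ y" for x y
    using assms by (simp add: stochastic_matrix_def)
  have "M $ x $ y \<le> (\<Sum>y\<in>UNIV. M $ x $ y)"
    by (rule member_le_sum) (use nonneg in auto)
  then show "M $ x $ y \<le> 1"
    using assms by (simp add: stochastic_matrix_def)
qed

text \<open>Used in the form that an off-diagonal entry is at most the mass missing from the
  diagonal entry of its row.\<close>

lemma stochastic_matrix_two_entries: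
  fixes M :: "real ^ 's::finite ^ 's"
  assumes "stochastic_matrix M" and "x \<noteq> y"
  shows "M $ x $ x + M $ x $ y \<le> 1"
proof -
  have "(\<Sum>z\<in>{x, y}. M $ x $ z) \<le> (\<Sum>z\<in>UNIV. M $ x $ z)"
    by (rule sum_mono2) (use stochastic_matrix_entry(1)[OF assms(1)] in auto)
  then show ?thesis
    using assms by (simp add: stochastic_matrix_def)
qed

lemma row_sum_mult_stochastic:
  fixes M N :: "real ^ 's::finite ^ 's"
  assumes "stochastic_matrix N"
  shows "(\<Sum>y\<in>UNIV. (M ** N) $ x $ y) = (\<Sum>z\<in>UNIV. M $ x $ z)"
proof -
  have "(\<Sum>y\<in>UNIV. (M ** N) $ x $ y) = (\<Sum>z\<in>UNIV. \<Sum>y\<in>UNIV. M $ x $ z * N $ z $ y)"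
    unfolding matrix_mult_nth by (rule sum.swap)
  also have "\<dots> = (\<Sum>z\<in>UNIV. M $ x $ z)"
    using assms by (simp add: stochastic_matrix_def flip: sum_distrib_left)
  finally show ?thesis .
qed

lemma stochastic_matrix_mult:
  fixes M N :: "real ^ 's::finite ^ 's"
  assumes "stochastic_matrix M" and "stochastic_matrix N"
  shows "stochastic_matrix (M ** N)"
  unfolding stochastic_matrix_def
proof (intro conjI allI)
  show "0 \<le> (M ** N) $ x $ y" for x y
    unfolding matrix_mult_nth
    by (intro sum_nonneg mult_nonneg_nonneg stochastic_matrix_entry assms)
  show "(\<Sum>y\<in>UNIV. (M ** N) $ x $ y) = 1" for x
    using assms(1) by (simp add: row_sum_mult_stochastic[OF assms(2)] stochastic_matrix_def)
qed

lemma stochastic_matrix_convex_comb: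
  fixes M N :: "real ^ 's::finite ^ 's"
  assumes "stochastic_matrix M" and "stochastic_matrix N"
    and "0 \<le> a" and "0 \<le> b" and "a + b = 1"
  shows "stochastic_matrix (a *\<^sub>R M + b *\<^sub>R N)"
  using assms by (auto simp: stochastic_matrix_def sum.distrib simp flip: sum_distrib_left)

lemma identical_rows_nth: "identical_rows M \<longleftrightarrow> (\<forall>x y z. M $ x $ z = M $ y $ z)"
  by (auto simp: identical_rows_def row_def vec_eq_iff)

lemma identical_rows_mult: "identical_rows M \<Longrightarrow> identical_rows (M ** N)"
  for M N :: "real ^ 's::finite ^ 's"
  unfolding identical_rows_nth matrix_mult_nth
  by (intro allI sum.cong refl arg_cong2[where f = "(*)"]) blast

lemma identical_rows_comb:
  "identical_rows M \<Longrightarrow> identical_rows N \<Longrightarrow> identical_rows (a *\<^sub>R M + b *\<^sub>R N)"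
  for M N :: "real ^ 's::finite ^ 's"
  unfolding identical_rows_nth vector_add_component vector_scaleR_component
  by (intro allI arg_cong2[where f = "(+)"] arg_cong2[where f = "scaleR"] refl) blast+

text \<open>Every column of \<open>N\<close> is constant, and averaging a constant with weights of
  total mass 1 returns it.\<close>

lemma stochastic_mult_identical_rows:
  fixes M N :: "real ^ 's::finite ^ 's"
  assumes "stochastic_matrix M" and "identical_rows N"
  shows "M ** N = N"
proof -
  have "(M ** N) $ x $ y = N $ x $ y" for x y
  proof -
    have "(M ** N) $ x $ y = (\<Sum>z\<in>UNIV. M $ x $ z * N $ x $ y)"
      unfolding matrix_mult_nth using assms(2)
      by (intro sum.cong refl arg_cong2[where f = "(*)"]) (simp add: identical_rows_nth)
    also have "\<dots> = N $ x $ y"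
      using assms(1) by (simp add: stochastic_matrix_def flip: sum_distrib_right)
    finally show ?thesis .
  qed
  then show ?thesis
    by (simp add: vec_eq_iff)
qed

section \<open>Mixtures with a matrix of identical rows\<close>

definition uniform_matrix :: "real ^ 's::finite ^ 's" where
  "uniform_matrix = (\<chi> x y. 1 / real CARD('s))"

lemma uniform_matrix:
  "stochastic_matrix uniform_matrix" "positive_matrix uniform_matrix"
  "identical_rows uniform_matrix"
  by (auto simp: uniform_matrix_def stochastic_matrix_def positive_matrix_def
      identical_rows_nth)

text \<open>The parameter \<open>q\<close> is the weight of the remainder \<open>A\<close>, since it
  is these weights that multiply under composition.\<close>

definition row_mixture :: "real \<Rightarrow> real ^ 's::finite ^ 's \<Rightarrow> bool" where
  "row_mixture q M \<longleftrightarrow> (\<exists>\<Psi> A. stochastic_matrix \<Psi> \<and> positive_matrix \<Psi> \<and>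
     identical_rows \<Psi> \<and> stochastic_matrix A \<and> M = (1 - q) *\<^sub>R \<Psi> + q *\<^sub>R A)"

lemma row_mixture_1: "stochastic_matrix M \<Longrightarrow> row_mixture 1 M"
  unfolding row_mixture_def
  by (intro exI[of _ uniform_matrix] exI[of _ M]) (simp add: uniform_matrix)

lemma row_mixture_mult:
  fixes M N :: "real ^ 's::finite ^ 's"
  assumes M: "row_mixture r M" and N: "row_mixture q N"
    and r: "0 < r" "r \<le> 1" and q: "0 < q" "q < 1"
  shows "row_mixture (r * q) (M ** N)"
proof -
  obtain \<Psi> A where \<Psi>: "stochastic_matrix \<Psi>" "positive_matrix \<Psi>" "identical_rows \<Psi>"
    and A: "stochastic_matrix A" and M_eq: "M = (1 - r) *\<^sub>R \<Psi> + r *\<^sub>R A"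
    using M unfolding row_mixture_def by blast
  obtain \<Phi> B where \<Phi>: "stochastic_matrix \<Phi>" "positive_matrix \<Phi>" "identical_rows \<Phi>"
    and B: "stochastic_matrix B" and N_eq: "N = (1 - q) *\<^sub>R \<Phi> + q *\<^sub>R B"
    using N unfolding row_mixture_def by blast
  have N_st: "stochastic_matrix N"
    unfolding N_eq using q by (intro stochastic_matrix_convex_comb \<Phi> B) auto
  have rq: "r * q < 1"
    using mult_right_mono[OF r(2), of q] q by linarith
  \<comment> \<open>The terms with identical rows have total mass
    \<open>(1 - r) + r * (1 - q) = 1 - r * q\<close>; \<open>a\<close> and \<open>b\<close> are
    their shares of it. The bound \<open>q < 1\<close> makes this mass positive.\<close>
  define a where "a = (1 - r) / (1 - r * q)"
  define b where "b = r * (1 - q) / (1 - r * q)"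
  have a: "0 \<le> a" and b: "0 < b" and ab: "a + b = 1"
    using r q rq by (auto simp: a_def b_def field_simps)
  define X where "X = a *\<^sub>R (\<Psi> ** N) + b *\<^sub>R \<Phi>"
  have "stochastic_matrix X"
    unfolding X_def using a b ab by (intro stochastic_matrix_convex_comb stochastic_matrix_mult \<Psi> \<Phi> N_st) auto
  moreover have "identical_rows X"
    unfolding X_def by (intro identical_rows_comb identical_rows_mult \<Psi> \<Phi>)
  \<comment> \<open>Positivity is taken from the \<Phi> term, because \<open>a = 0\<close> when
    \<open>r = 1\<close>.\<close>
  moreover have "positive_matrix X"
    unfolding positive_matrix_def X_def
    using a b \<Phi>(2) stochastic_matrix_entry(1)[OF stochastic_matrix_mult[OF \<Psi>(1) N_st]]
    by (auto simp: positive_matrix_def intro!: add_nonneg_pos)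
  moreover have "M ** N = (1 - r * q) *\<^sub>R X + (r * q) *\<^sub>R (A ** B)"
  proof -
    have "A ** N = (1 - q) *\<^sub>R \<Phi> + q *\<^sub>R (A ** B)"
      unfolding N_eq
      by (simp add: matrix_add_ldistrib matrix_scalar_ac stochastic_mult_identical_rows A \<Phi>
          flip: scalar_matrix_assoc)
    then have "M ** N = (1 - r) *\<^sub>R (\<Psi> ** N) + r *\<^sub>R ((1 - q) *\<^sub>R \<Phi> + q *\<^sub>R (A ** B))"
      unfolding M_eq by (simp add: matrix_add_rdistrib flip: scalar_matrix_assoc)
    moreover have "(1 - r * q) * a = 1 - r" "(1 - r * q) * b = r * (1 - q)"
      using rq by (auto simp: a_def b_def)
    ultimately show ?thesis
      unfolding X_def by (simp add: scaleR_add_right)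
  qed
  ultimately show ?thesis
    unfolding row_mixture_def using stochastic_matrix_mult[OF A B] by blast
qed

text \<open>Doeblin minorisation: removing \<delta> times the uniform matrix leaves nonnegative
  entries with row sums \<open>1 - \<delta>\<close>, and rescaling makes the remainder
  stochastic.\<close>

lemma row_mixture_if_entries_ge:
  fixes M :: "real ^ 's::finite ^ 's"
  assumes M: "stochastic_matrix M" and ge: "\<And>x y. \<delta> / real CARD('s) \<le> M $ x $ y"
    and \<delta>: "0 \<le> \<delta>" "\<delta> < 1"
  shows "row_mixture (1 - \<delta>) M"
proof -
  define A where "A = (1 / (1 - \<delta>)) *\<^sub>R (M - \<delta> *\<^sub>R uniform_matrix)"
  have "M = (1 - (1 - \<delta>)) *\<^sub>R uniform_matrix + (1 - \<delta>) *\<^sub>R A"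
    using \<delta> by (simp add: A_def)
  moreover have "stochastic_matrix A"
    unfolding stochastic_matrix_def
  proof (intro conjI allI)
    show "0 \<le> A $ x $ y" for x y
      using \<delta> ge[of x y] by (simp add: A_def uniform_matrix_def)
    show "(\<Sum>y\<in>UNIV. A $ x $ y) = 1" for x
    proof -
      have "(\<Sum>y\<in>UNIV. A $ x $ y) =
          ((\<Sum>y\<in>UNIV. M $ x $ y) - \<delta> * (\<Sum>y\<in>UNIV. uniform_matrix $ x $ y)) / (1 - \<delta>)"
        by (simp add: A_def sum_subtractf sum_distrib_left flip: sum_divide_distrib)
      also have "\<dots> = 1"
        using M \<delta> by (simp add: stochastic_matrix_def uniform_matrix_def)
      finally show ?thesis .
    qed
  qed
  ultimately show ?thesis
    unfolding row_mixture_def using uniform_matrix by blast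
qed

section \<open>The Chapman--Kolmogorov equation\<close>

lemma zero_if_integral_equation:
  fixes D R :: "real \<Rightarrow> real ^ 's::finite ^ 's"
  assumes D: "\<And>v. 0 \<le> v \<Longrightarrow> ((\<lambda>u. D u ** R u) has_integral D v) {0..v}"
    and D_bound: "\<And>v x y. 0 \<le> v \<Longrightarrow> \<bar>D v $ x $ y\<bar> \<le> 1"
    and R_bound: "\<And>v x y. 0 \<le> v \<Longrightarrow> \<bar>R v $ x $ y\<bar> \<le> K"
    and v: "0 \<le> v"
  shows "D v = 0"
proof -
  \<comment> \<open>The factor \<open>CARD('s)\<close> pays for the sum over intermediate states in
    an entry of \<open>D u ** R u\<close>.\<close>
  define C where "C = real CARD('s) * K"
  have bound: "\<bar>D v $ x $ y\<bar> \<le> (C * v) ^ n / fact n" if "0 \<le> v" for n v x y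
    using that
  proof (induction n arbitrary: v x y)
    case 0
    then show ?case using D_bound by simp
  next
    case (Suc n)
    \<comment> \<open>Majorant of the integrand obtained from the induction hypothesis; its integral
      over \<open>{0..v}\<close> is the next bound.\<close>
    let ?g = "\<lambda>u. C ^ Suc n / fact n * u ^ n"
    have "((\<lambda>u. (D u ** R u) $ x $ y) has_integral D v $ x $ y) {0..v}"
      using has_integral_linear[OF has_integral_linear[OF D[OF Suc.prems]
            bounded_linear_vec_nth[of x]] bounded_linear_vec_nth[of y]]
      by (simp add: o_def)
    moreover have "(?g has_integral
        C ^ Suc n / fact n * (v ^ Suc n / real (Suc n)) -
        C ^ Suc n / fact n * (0 ^ Suc n / real (Suc n))) {0..v}"
    proof (rule fundamental_theorem_of_calculus[OF Suc.prems])
      fix u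
      have "((\<lambda>u. u ^ Suc n / real (Suc n)) has_real_derivative u ^ n) (at u within {0..v})"
        using DERIV_cdivide[OF DERIV_pow[of "Suc n" u "{0..v}"], of "real (Suc n)"] by simp
      from DERIV_cmult[OF this, of "C ^ Suc n / fact n"]
      show "((\<lambda>u. C ^ Suc n / fact n * (u ^ Suc n / real (Suc n)))
          has_vector_derivative ?g u) (at u within {0..v})"
        by (simp only: has_real_derivative_iff_has_vector_derivative)
    qed
    moreover have "norm ((D u ** R u) $ x $ y) \<le> ?g u" if "u \<in> {0..v}" for u
    proof -
      have "\<bar>(D u ** R u) $ x $ y\<bar> \<le> (\<Sum>z\<in>UNIV. \<bar>D u $ x $ z * R u $ z $ y\<bar>)"
        unfolding matrix_mult_nth by (rule sum_abs)
      also have "\<dots> \<le> (\<Sum>z\<in>(UNIV :: 's set). (C * u) ^ n / fact n * K)"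
      proof (rule sum_mono)
        fix z
        show "\<bar>D u $ x $ z * R u $ z $ y\<bar> \<le> (C * u) ^ n / fact n * K"
          unfolding abs_mult using Suc.IH[of u x z] R_bound[of u z y] that
          by (intro mult_mono) (auto intro: order_trans[OF abs_ge_zero])
      qed
      also have "\<dots> = ?g u"
        by (simp add: C_def power_mult_distrib)
      finally show ?thesis by simp
    qed
    ultimately have "norm (D v $ x $ y) \<le> C ^ Suc n / fact n * (v ^ Suc n / real (Suc n))
        - C ^ Suc n / fact n * (0 ^ Suc n / real (Suc n))"
      by (metis (no_types, lifting) has_integral_integrable integral_norm_bound_integral integral_unique)
    also have "\<dots> = (C * v) ^ Suc n / fact (Suc n)"
      by (simp add: power_mult_distrib field_simps)
    finally show ?case by simp
  qed
  have "D v $ x $ y = 0" for x y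
  proof -
    \<comment> \<open>These are the terms of the convergent series for
      \<open>exp (C * v)\<close>.\<close>
    have "(\<lambda>n. (C * v) ^ n / fact n) \<longlonglongrightarrow> 0"
      using summable_LIMSEQ_zero[OF summable_exp[of "C * v"]] by (simp add: field_simps)
    from LIMSEQ_le_const[OF this, of "\<bar>D v $ x $ y\<bar>"] bound[OF v] show ?thesis by auto
  qed
  then show ?thesis by (simp add: vec_eq_iff)
qed

text \<open>Passes from the Lebesgue integral to the gauge integral, whose rules for subintervals,
  shifts and bounded linear maps are used from here on.\<close>

lemma forward_has_integral:
  assumes "transition_matrices Q P" and "0 \<le> t" and "0 \<le> s"
  shows "((\<lambda>u. P t (t + u) ** Q (t + u)) has_integral (P t (t + s) - mat 1)) {0..s}"
proof -
  have I: "set_integrable lborel {0..s} (\<lambda>u. P t (t + u) ** Q (t + u))"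
    and eq: "P t (t + s) = mat 1 + (LINT u:{0..s}|lborel. P t (t + u) ** Q (t + u))"
    using assms by (auto simp: transition_matrices_def kolmogorov_forward_def)
  then show ?thesis
    using set_borel_integral_eq_integral[OF I] by (simp add: has_integral_iff eq)
qed

text \<open>The integral over \<open>{0..a + v}\<close> minus the one over \<open>{0..a}\<close>,
  translated by the elapsed time \<open>a = s - r\<close>.\<close>

lemma forward_has_integral_shift:
  assumes "transition_matrices Q P" and "0 \<le> r" and "r \<le> s" and "0 \<le> v"
  shows "((\<lambda>u. P r (s + u) ** Q (s + u)) has_integral (P r (s + v) - P r s)) {0..v}"
proof -
  define a where "a = s - r"
  define f where "f u = P r (r + u) ** Q (r + u)" for u
  have a: "0 \<le> a" "r + a = s" "r + (a + v) = s + v"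
    using assms by (auto simp: a_def)
  have I1: "(f has_integral (P r s - mat 1)) {0..a}"
    and I2: "(f has_integral (P r (s + v) - mat 1)) {0..a + v}"
    using forward_has_integral[OF assms(1,2), of a] forward_has_integral[OF assms(1,2), of "a + v"]
      a assms(4) unfolding f_def by auto
  have "f integrable_on {a..a + v}"
    by (rule integrable_on_subinterval[OF has_integral_integrable[OF I2]]) (use a in auto)
  then obtain j where j: "(f has_integral j) {a..a + v}"
    by (auto simp: integrable_on_def)
  have "(f has_integral (P r s - mat 1 + j)) {0..a + v}"
    by (rule has_integral_combine[OF _ _ I1 j]) (use a assms in auto)
  then have "P r s - mat 1 + j = P r (s + v) - mat 1"
    using I2 has_integral_unique by blast
  then have "j = P r (s + v) - P r s"
    by (simp add: algebra_simps)
  moreover have "f (u + a) = P r (s + u) ** Q (s + u)" for u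
    unfolding f_def using a by (metis add.assoc add.commute)
  ultimately show ?thesis
    using has_integral_shift_real_ivl[OF j, of a] by simp
qed

text \<open>As functions of \<open>v\<close>, both \<open>P r (s + v)\<close> and
  \<open>P r s ** P s (s + v)\<close> solve the forward equation from time \<open>s\<close> with
  initial value \<open>P r s\<close>, so their difference \<open>D\<close> solves the homogeneous
  equation.\<close>

lemma chapman_kolmogorov:
  fixes Q :: "real \<Rightarrow> real ^ 's::finite ^ 's"
  assumes P: "transition_matrices Q P" and Q: "\<And>t x y. 0 \<le> t \<Longrightarrow> \<bar>Q t $ x $ y\<bar> \<le> K"
    and r: "0 \<le> r" "r \<le> s" "s \<le> t"
  shows "P r t = P r s ** P s t"
proof -
  define D where "D v = P r (s + v) - P r s ** P s (s + v)" for v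
  have st: "stochastic_matrix (P a b)" if "0 \<le> a" "a \<le> b" for a b
    using P that by (simp add: transition_matrices_def)
  have "D (t - s) = 0"
  proof (rule zero_if_integral_equation[where R = "\<lambda>u. Q (s + u)" and K = K])
    fix v :: real assume v: "0 \<le> v"
    have "bounded_linear ((**) (P r s))"
      unfolding linear_conv_bounded_linear[symmetric]
      by (rule linearI) (simp_all add: matrix_add_ldistrib matrix_scalar_ac scalar_matrix_assoc)
    from has_integral_linear[OF forward_has_integral[OF P _ v, of s] this] r
    have "((\<lambda>u. P r s ** (P s (s + u) ** Q (s + u)))
        has_integral (P r s ** (P s (s + v) - mat 1))) {0..v}"
      by (simp add: o_def)
    from has_integral_diff[OF forward_has_integral_shift[OF P r(1,2) v] this]
    show "((\<lambda>u. D u ** Q (s + u)) has_integral D v) {0..v}"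
      unfolding D_def by (simp add: matrix_mul_assoc matrix_diff_ldistrib matrix_diff_rdistrib)
    show "\<bar>D v $ x $ y\<bar> \<le> 1" for x y
    proof -
      have "stochastic_matrix (P r (s + v))" "stochastic_matrix (P r s ** P s (s + v))"
        using r v by (auto intro!: st stochastic_matrix_mult)
      from this[THEN stochastic_matrix_entry(1), of x y] this[THEN stochastic_matrix_entry(2), of x y]
      show ?thesis by (simp add: D_def abs_le_iff)
    qed
    show "\<bar>Q (s + v) $ x $ y\<bar> \<le> K" for x y
      using Q v r by simp
  qed (use r in auto)
  then show ?thesis
    by (simp add: D_def)
qed

section \<open>Uniform positivity\<close>

text \<open>Rates of transitions are bounded by assumption and other off-diagonal rates vanish; a
  diagonal entry is minus the sum of the others in its row.\<close>

lemma rates_abs_bounded: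
  fixes Q :: "real \<Rightarrow> real ^ 's::finite ^ 's"
  assumes rate: "\<And>t. t \<ge> 0 \<Longrightarrow> rate_matrix (Q t)"
    and struct: "constant_irreducible_structure Q" and bounded: "bounded_rates Q"
  obtains K where "0 < K" "\<And>t x y. 0 \<le> t \<Longrightarrow> \<bar>Q t $ x $ y\<bar> \<le> K"
proof -
  have "\<exists>B\<ge>0. x \<noteq> y \<longrightarrow> (\<forall>t\<ge>0. Q t $ x $ y \<le> B)" for x y
  proof (cases "(x, y) \<in> transitions (Q 1)")
    case True
    then have "bdd_above ((\<lambda>t. Q t $ x $ y) ` {0..})"
      using bounded by (auto simp: bounded_rates_def)
    then obtain B where "\<forall>t\<ge>0. Q t $ x $ y \<le> B"
      by (auto simp: bdd_above_def)
    then show ?thesis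
      by (intro exI[of _ "max B 0"]) (auto simp: le_max_iff_disj)
  next
    case False
    then have "\<forall>t\<ge>0. Q t $ x $ y \<le> 0"
      using struct by (force simp: constant_irreducible_structure_def transitions_def)
    then show ?thesis by blast
  qed
  then obtain B where B: "\<And>x y. 0 \<le> B x y"
    "\<And>x y t. x \<noteq> y \<Longrightarrow> 0 \<le> t \<Longrightarrow> Q t $ x $ y \<le> B x y"
    by metis
  \<comment> \<open>Summing the bounds, rather than taking their maximum, also covers the diagonal;
    the \<open>+ 1\<close> keeps \<open>K\<close> positive when all rates vanish.\<close>
  define K where "K = (\<Sum>x\<in>UNIV. \<Sum>y\<in>UNIV. B x y) + 1"
  have row: "(\<Sum>y\<in>UNIV. B x y) \<le> K" for x
    using member_le_sum[of x UNIV "\<lambda>x. \<Sum>y\<in>UNIV. B x y"] B(1)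
    by (auto simp: K_def sum_nonneg)
  have "\<bar>Q t $ x $ y\<bar> \<le> K" if t: "0 \<le> t" for t x y
  proof -
    have nonneg: "0 \<le> Q t $ x $ z" if "x \<noteq> z" for z
      using rate[OF t] that by (simp add: rate_matrix_def)
    show ?thesis
    proof (cases "x = y")
      case True
      have "(\<Sum>z\<in>UNIV. Q t $ x $ z) = Q t $ x $ x + (\<Sum>z\<in>UNIV - {x}. Q t $ x $ z)"
        by (rule sum.remove) auto
      then have "Q t $ x $ x = - (\<Sum>z\<in>UNIV - {x}. Q t $ x $ z)"
        using rate[OF t] by (simp add: rate_matrix_def)
      moreover have "0 \<le> (\<Sum>z\<in>UNIV - {x}. Q t $ x $ z)"
        using nonneg by (intro sum_nonneg) auto
      moreover have "(\<Sum>z\<in>UNIV - {x}. Q t $ x $ z) \<le> (\<Sum>z\<in>UNIV - {x}. B x z)"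
        using B(2) t by (intro sum_mono) auto
      moreover have "\<dots> \<le> (\<Sum>z\<in>UNIV. B x z)"
        using B(1) by (intro sum_mono2) auto
      ultimately show ?thesis
        using row[of x] True by simp
    next
      case False
      have "B x y \<le> (\<Sum>z\<in>UNIV. B x z)"
        using B(1) by (intro member_le_sum) auto
      then show ?thesis
        using False nonneg[of y] B(2)[of x y t] row[of x] t by simp
    qed
  qed
  moreover have "0 < K"
    using B(1) by (auto simp: K_def intro!: add_nonneg_pos sum_nonneg)
  ultimately show ?thesis using that by blast
qed

lemma rates_bounded_below:
  fixes Q :: "real \<Rightarrow> real ^ 's::finite ^ 's"
  assumes struct: "constant_irreducible_structure Q" and bounded: "bounded_rates Q"
  obtains q where "0 < q"
    "\<And>t x y. 0 \<le> t \<Longrightarrow> (x, y) \<in> transitions (Q 1) \<Longrightarrow> q \<le> Q t $ x $ y"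
proof -
  define m where "m e = (INF t\<in>{0..}. Q t $ fst e $ snd e)" for e
  \<comment> \<open>There are finitely many transitions, so the least infimum is positive. Inserting
    \<open>1\<close> covers the empty set of transitions on a one-point space.\<close>
  define q where "q = Min (insert 1 (m ` transitions (Q 1)))"
  have "0 < q"
    using bounded unfolding q_def by (subst Min_gr_iff) (auto simp: m_def bounded_rates_def)
  moreover have "q \<le> Q t $ x $ y" if t: "0 \<le> t" and e: "(x, y) \<in> transitions (Q 1)" for t x y
  proof -
    have "q \<le> m (x, y)"
      unfolding q_def using e by (intro Min_le) auto
    also have "m (x, y) \<le> Q t $ x $ y"
      unfolding m_def fst_conv snd_conv
    proof (rule cINF_lower)
      show "bdd_below ((\<lambda>t. Q t $ x $ y) ` {0..})"
        using struct e unfolding constant_irreducible_structure_def transitions_def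
        by (intro bdd_belowI[of _ 0]) (force intro: less_imp_le)
    qed (use t in simp)
    finally show ?thesis .
  qed
  ultimately show ?thesis using that by blast
qed

section \<open>Short-time lower bounds for the entries of \<open>P\<close>\<close>

lemma forward_entry_has_integral:
  fixes P :: "real \<Rightarrow> real \<Rightarrow> real ^ 's::finite ^ 's"
  assumes "transition_matrices Q P" and "0 \<le> t" and "0 \<le> h"
  shows "((\<lambda>u. (P t (t + u) ** Q (t + u)) $ x $ y) has_integral
    (P t (t + h) $ x $ y - (if x = y then 1 else 0))) {0..h}"
  using has_integral_linear[OF has_integral_linear[OF forward_has_integral[OF assms]
        bounded_linear_vec_nth[of x]] bounded_linear_vec_nth[of y]]
  by (simp add: o_def mat_def)

text \<open>Mass leaves \<open>x\<close> at rate at most \<open>K\<close>: in the forward integrand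
  the term through \<open>x\<close> is at least \<open>- K\<close>, and the inflow from other states
  is nonnegative.\<close>

lemma diagonal_ge:
  fixes Q :: "real \<Rightarrow> real ^ 's::finite ^ 's"
  assumes rate: "\<And>t. t \<ge> 0 \<Longrightarrow> rate_matrix (Q t)" and P: "transition_matrices Q P"
    and K: "\<And>t x y. 0 \<le> t \<Longrightarrow> \<bar>Q t $ x $ y\<bar> \<le> K"
    and t: "0 \<le> t" and h: "0 \<le> h"
  shows "1 - K * h \<le> P t (t + h) $ x $ x"
proof -
  have "- K * h \<le> P t (t + h) $ x $ x - (if x = x then 1 else 0)"
  proof (rule has_integral_le[OF _ forward_entry_has_integral[OF P t h, of x x]])
    show "((\<lambda>u. - K) has_integral - K * h) {0..h}"
      using has_integral_const_real[of "- K" 0 h] h by (simp add: mult.commute)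
    show "- K \<le> (P t (t + u) ** Q (t + u)) $ x $ x" if "u \<in> {0..h}" for u
    proof -
      have st: "stochastic_matrix (P t (t + u))"
        using P t that by (simp add: transition_matrices_def)
      have "- K \<le> P t (t + u) $ x $ x * - K"
        using stochastic_matrix_entry[OF st, of x x] K[OF t, of x x]
        by (simp add: mult_left_le_one_le)
      also have "\<dots> \<le> P t (t + u) $ x $ x * Q (t + u) $ x $ x"
        using K[of "t + u" x x] t that stochastic_matrix_entry(1)[OF st]
        by (intro mult_left_mono) auto
      also have "\<dots> \<le> (P t (t + u) ** Q (t + u)) $ x $ x"
      proof -
        have "0 \<le> (\<Sum>z\<in>UNIV - {x}. P t (t + u) $ x $ z * Q (t + u) $ z $ x)"
          using rate[of "t + u"] t that stochastic_matrix_entry(1)[OF st]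
          by (intro sum_nonneg mult_nonneg_nonneg) (auto simp: rate_matrix_def)
        then show ?thesis
          unfolding matrix_mult_nth by (subst sum.remove[of _ x]) auto
      qed
      finally show ?thesis .
    qed
  qed
  then show ?thesis by simp
qed

text \<open>The inflow from \<open>x\<close> is at least \<open>q / 2\<close>, as the diagonal entry
  of \<open>P\<close> is at least 1/2. The outflow from \<open>y\<close> is at most
  \<open>K\<^sup>2 * h\<close>, as the mass at \<open>y\<close> is at most \<open>K * h\<close>. All
  other inflow is nonnegative.\<close>

lemma transition_ge:
  fixes Q :: "real \<Rightarrow> real ^ 's::finite ^ 's"
  assumes rate: "\<And>t. t \<ge> 0 \<Longrightarrow> rate_matrix (Q t)" and P: "transition_matrices Q P"
    and K: "\<And>t x y. 0 \<le> t \<Longrightarrow> \<bar>Q t $ x $ y\<bar> \<le> K"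
    and q: "0 \<le> q" "\<And>t. 0 \<le> t \<Longrightarrow> q \<le> Q t $ x $ y" and xy: "x \<noteq> y"
    and t: "0 \<le> t" and h: "0 \<le> h" "K * h \<le> 1/2"
  shows "h * (q / 2 - K\<^sup>2 * h) \<le> P t (t + h) $ x $ y"
proof -
  have K0: "0 \<le> K"
    using K[OF t, of x x] by simp
  have "h * (q / 2 - K\<^sup>2 * h) \<le> P t (t + h) $ x $ y - (if x = y then 1 else 0)"
  proof (rule has_integral_le[OF _ forward_entry_has_integral[OF P t h(1), of x y]])
    show "((\<lambda>u. q / 2 - K\<^sup>2 * h) has_integral h * (q / 2 - K\<^sup>2 * h)) {0..h}"
      using has_integral_const_real[of "q / 2 - K\<^sup>2 * h" 0 h] h by simp
    show "q / 2 - K\<^sup>2 * h \<le> (P t (t + u) ** Q (t + u)) $ x $ y" if u: "u \<in> {0..h}" for u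
    proof -
      let ?p = "P t (t + u)" and ?Q = "Q (t + u)"
      have st: "stochastic_matrix ?p"
        using P t u by (simp add: transition_matrices_def)
      have Ku: "K * u \<le> K * h"
        using u K0 by (intro mult_left_mono) auto
      have diag: "1 - K * u \<le> ?p $ x $ x"
        using diagonal_ge[OF rate P K t, of u x] u by simp
      have "(1/2) * q \<le> ?p $ x $ x * ?Q $ x $ y"
        using diag Ku h q(1) q(2)[of "t + u"] t u stochastic_matrix_entry(1)[OF st]
        by (intro mult_mono) auto
      moreover have "?p $ x $ y * - ?Q $ y $ y \<le> (K * h) * K"
      proof (rule order_trans)
        show "?p $ x $ y * - ?Q $ y $ y \<le> ?p $ x $ y * K"
          using K[of "t + u" y y] t u stochastic_matrix_entry(1)[OF st]
          by (intro mult_left_mono) (auto simp: abs_le_iff)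
        show "?p $ x $ y * K \<le> (K * h) * K"
          using stochastic_matrix_two_entries[OF st xy] diag Ku K0
          by (intro mult_right_mono) auto
      qed
      moreover have "?p $ x $ x * ?Q $ x $ y + ?p $ x $ y * ?Q $ y $ y \<le> (?p ** ?Q) $ x $ y"
      proof -
        have "0 \<le> (\<Sum>z\<in>UNIV - {y} - {x}. ?p $ x $ z * ?Q $ z $ y)"
          using rate[of "t + u"] t u stochastic_matrix_entry(1)[OF st]
          by (intro sum_nonneg mult_nonneg_nonneg) (auto simp: rate_matrix_def)
        then show ?thesis
          unfolding matrix_mult_nth using xy
          by (subst sum.remove[of _ y], simp, simp) (subst sum.remove[of _ x], auto)
      qed
      ultimately show ?thesis
        by (simp add: power2_eq_square algebra_simps)
    qed
  qed
  then show ?thesis using xy by simp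
qed

section \<open>Composition of short steps along paths\<close>

text \<open>Waiting steps pad a path, so that all pairs of states can share one path length.\<close>

lemma relpow_reflcl_add: "(x, y) \<in> T ^^ k \<Longrightarrow> (x, y) \<in> (T\<^sup>=) ^^ (k + j)"
proof (induction j)
  case 0
  have "T ^^ k \<subseteq> (T\<^sup>=) ^^ k"
    by (induction k) (auto intro: relcomp_mono[THEN subsetD])
  then show ?case using 0 by auto
next
  case (Suc j)
  then show ?case by auto
qed

text \<open>In each Chapman-Kolmogorov sum only the term of the path's last intermediate state is
  kept; the others are nonnegative.\<close>

lemma relpow_entry_ge:
  fixes Q :: "real \<Rightarrow> real ^ 's::finite ^ 's"
  assumes P: "transition_matrices Q P" and Q: "\<And>t x y. 0 \<le> t \<Longrightarrow> \<bar>Q t $ x $ y\<bar> \<le> K"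
    and a: "0 \<le> a" "\<And>t x y. 0 \<le> t \<Longrightarrow> (x, y) \<in> R \<Longrightarrow> a \<le> P t (t + h) $ x $ y"
    and h: "0 \<le> h" and s: "0 \<le> s" and xy: "(x, y) \<in> R ^^ n"
  shows "a ^ n \<le> P s (s + real n * h) $ x $ y"
  using xy
proof (induction n arbitrary: y)
  case 0
  \<comment> \<open>\<open>P s s\<close> is the identity because the forward integral over a single
    point vanishes.\<close>
  have "P s (s + 0) - mat 1 = 0"
    by (rule has_integral_unique[OF forward_has_integral[OF P s order_refl] has_integral_null_real]) simp
  then show ?case using 0 by (simp add: mat_def)
next
  case (Suc n)
  let ?t = "s + real n * h"
  from Suc.prems obtain z where z: "(x, z) \<in> R ^^ n" "(z, y) \<in> R" by auto
  have st: "stochastic_matrix (P s ?t)" "stochastic_matrix (P ?t (?t + h))"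
    using P s h by (auto simp: transition_matrices_def)
  have "a ^ Suc n = a ^ n * a" by simp
  also have "\<dots> \<le> P s ?t $ x $ z * P ?t (?t + h) $ z $ y"
    using Suc.IH[OF z(1)] a z(2) s h stochastic_matrix_entry(1)[OF st(1)]
    by (intro mult_mono) auto
  also have "\<dots> \<le> (\<Sum>z\<in>UNIV. P s ?t $ x $ z * P ?t (?t + h) $ z $ y)"
    by (rule member_le_sum[where f = "\<lambda>z. P s ?t $ x $ z * P ?t (?t + h) $ z $ y"])
      (auto intro!: mult_nonneg_nonneg stochastic_matrix_entry st)
  also have "\<dots> = (P s ?t ** P ?t (?t + h)) $ x $ y"
    by (simp add: matrix_mult_nth)
  also have "P s ?t ** P ?t (?t + h) = P s (?t + h)"
    using chapman_kolmogorov[OF P Q s, of ?t "?t + h"] s h by simp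
  also have "?t + h = s + real (Suc n) * h"
    by (simp add: algebra_simps)
  finally show ?case .
qed

lemma transition_matrices_uniformly_positive:
  fixes Q :: "real \<Rightarrow> real ^ 's::finite ^ 's"
  assumes rate: "\<And>t. t \<ge> 0 \<Longrightarrow> rate_matrix (Q t)"
    and struct: "constant_irreducible_structure Q" and bounded: "bounded_rates Q"
    and P: "transition_matrices Q P" and u0: "u0 > 0"
  obtains \<epsilon> where "0 < \<epsilon>" "\<And>s x y. 0 \<le> s \<Longrightarrow> \<epsilon> \<le> P s (s + u0) $ x $ y"
proof -
  obtain K where K: "0 < K" "\<And>t x y. 0 \<le> t \<Longrightarrow> \<bar>Q t $ x $ y\<bar> \<le> K"
    using rates_abs_bounded[OF rate struct bounded] by blast
  obtain q where q: "0 < q"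
    "\<And>t x y. 0 \<le> t \<Longrightarrow> (x, y) \<in> transitions (Q 1) \<Longrightarrow> q \<le> Q t $ x $ y"
    using rates_bounded_below[OF struct bounded] by blast
  let ?T = "transitions (Q 1)"
  \<comment> \<open>For \<open>h \<le> h0\<close>, the first bound gives
    \<open>K * h \<le> 1/2\<close> and the second gives
    \<open>q / 2 - K\<^sup>2 * h \<ge> q / 4\<close>.\<close>
  define h0 where "h0 = min (1 / (2 * K)) (q / (4 * K\<^sup>2))"
  have h0: "0 < h0" using K q by (simp add: h0_def)
  obtain m where m: "u0 / h0 < real m"
    using reals_Archimedean2 by blast
  \<comment> \<open>The summand \<open>card ?T\<close> leaves room for a path between any two
    states, and \<open>m\<close> makes the step \<open>u0 / n\<close> at most
    \<open>h0\<close>.\<close>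
  define n where "n = card ?T + m"
  define h where "h = u0 / real n"
  have m0: "0 < real m"
    using m u0 h0 by (meson divide_pos_pos less_trans)
  have h: "0 < h" "real n * h = u0"
    using m0 u0 by (auto simp: h_def n_def)
  have "h \<le> u0 / real m"
    unfolding h_def using m0 u0 by (intro divide_left_mono) (auto simp: n_def)
  also have "\<dots> \<le> h0"
    using m m0 h0 by (simp add: field_simps)
  finally have "h \<le> 1 / (2 * K)" "h \<le> q / (4 * K\<^sup>2)"
    by (auto simp: h0_def)
  then have Kh: "K * h \<le> 1/2" "K\<^sup>2 * h \<le> q / 4"
    using K by (auto simp: field_simps)
  \<comment> \<open>The first bound serves waiting steps, the second one proper transitions.\<close>
  define a where "a = min (1/2) (h * (q / 4))"
  have a: "0 < a" using h q by (simp add: a_def)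
  have step: "a \<le> P t (t + h) $ x $ y" if t: "0 \<le> t" and xy: "(x, y) \<in> ?T\<^sup>=" for t x y
  proof (cases "x = y")
    case True
    then show ?thesis
      using diagonal_ge[OF rate P K(2) t, of h y] h Kh by (simp add: a_def)
  next
    case False
    then have "(x, y) \<in> ?T" using xy by simp
    then have "h * (q / 2 - K\<^sup>2 * h) \<le> P t (t + h) $ x $ y"
      using transition_ge[OF rate P K(2) _ _ False t, of q h] q h Kh by simp
    moreover have "h * (q / 4) \<le> h * (q / 2 - K\<^sup>2 * h)"
      using h Kh by (intro mult_left_mono) auto
    ultimately show ?thesis by (simp add: a_def)
  qed
  have "a ^ n \<le> P s (s + u0) $ x $ y" if s: "0 \<le> s" for s x y
  proof -
    have "(x, y) \<in> ?T\<^sup>*"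
      using struct
      unfolding constant_irreducible_structure_def irreducible_rate_matrix_def by blast
    \<comment> \<open>In a finite relation, reachability is witnessed by a path with at most as many
      steps as the relation has pairs.\<close>
    then obtain k where k: "k \<le> card ?T" "(x, y) \<in> ?T ^^ k"
      using rtrancl_finite_eq_relpow[of ?T] by auto
    have "(x, y) \<in> (?T\<^sup>=) ^^ n"
      using relpow_reflcl_add[OF k(2), of "n - k"] k(1) by (simp add: n_def)
    from relpow_entry_ge[OF P K(2) _ step _ s this] show ?thesis
      using a h by simp
  qed
  then show ?thesis using a that by (meson zero_less_power)
qed

section \<open>Iteration over intervals of length \<open>u0\<close>\<close>

theorem proposition1:
  fixes Q :: "real \<Rightarrow> real ^ 's::finite ^ 's"
    and P :: "real \<Rightarrow> real \<Rightarrow> real ^ 's ^ 's"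
    and u0 :: real
  assumes "\<And>t. t \<ge> 0 \<Longrightarrow> rate_matrix (Q t)"
    and "measurable_rates Q"
    and "constant_irreducible_structure Q"
    and "bounded_rates Q"
    and "transition_matrices Q P"
    and "u0 > 0"
  shows "\<exists>\<delta>::real. 0 < \<delta> \<and> \<delta> \<le> 1 \<and>
    (\<exists>(\<Psi> :: nat \<Rightarrow> real \<Rightarrow> real ^ 's ^ 's) (A :: nat \<Rightarrow> real \<Rightarrow> real ^ 's ^ 's).
      \<forall>k. \<forall>s\<ge>0.
        stochastic_matrix (\<Psi> k s) \<and> positive_matrix (\<Psi> k s) \<and> identical_rows (\<Psi> k s) \<and>
        stochastic_matrix (A k s) \<and>
        P s (s + real k * u0) =
          (1 - (1 - \<delta>) ^ k) *\<^sub>R \<Psi> k s + (1 - \<delta>) ^ k *\<^sub>R A k s)"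
proof -
  obtain K where K: "0 < K" "\<And>t x y. 0 \<le> t \<Longrightarrow> \<bar>Q t $ x $ y\<bar> \<le> K"
    using rates_abs_bounded[OF assms(1,3,4)] by blast
  obtain \<epsilon> where \<epsilon>: "0 < \<epsilon>" "\<And>s x y. 0 \<le> s \<Longrightarrow> \<epsilon> \<le> P s (s + u0) $ x $ y"
    using transition_matrices_uniformly_positive[OF assms(1,3,4,5,6)] by blast
  have st: "stochastic_matrix (P s t)" if "0 \<le> s" "s \<le> t" for s t
    using assms(5) that by (simp add: transition_matrices_def)
  \<comment> \<open>The factor \<open>CARD('s)\<close> turns the entrywise bound \<epsilon> into a
    multiple of the uniform matrix; the cap 1/2 keeps \<open>1 - \<delta>\<close> positive, as
    composing mixtures requires.\<close>
  define \<delta> where "\<delta> = min (1/2) (real CARD('s) * \<epsilon>)"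
  have \<delta>: "0 < \<delta>" "\<delta> < 1"
    using \<epsilon> by (auto simp: \<delta>_def)
  have step: "row_mixture (1 - \<delta>) (P s (s + u0))" if "0 \<le> s" for s
  proof (rule row_mixture_if_entries_ge)
    have "\<delta> / real CARD('s) \<le> \<epsilon>"
      by (simp add: \<delta>_def divide_le_eq mult.commute)
    then show "\<delta> / real CARD('s) \<le> P s (s + u0) $ x $ y" for x y
      using \<epsilon>(2)[OF that, of x y] by linarith
  qed (use st that \<delta> assms(6) in auto)
  have mixture: "row_mixture ((1 - \<delta>) ^ k) (P s (s + real k * u0))" if "0 \<le> s" for k s
  proof (induction k)
    \<comment> \<open>The remainder has weight 1 here, so it is \<open>P s s\<close> itself and the
      matrix with identical rows is arbitrary.\<close>
    case 0
    then show ?case using row_mixture_1[OF st[of s s]] that by simp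
  next
    case (Suc k)
    let ?t = "s + real k * u0"
    have t: "0 \<le> ?t" "s \<le> ?t" using that assms(6) by auto
    have "row_mixture ((1 - \<delta>) ^ k * (1 - \<delta>)) (P s ?t ** P ?t (?t + u0))"
      using \<delta> by (intro row_mixture_mult Suc.IH step t) (auto intro: power_le_one)
    moreover have "P s ?t ** P ?t (?t + u0) = P s (?t + u0)"
      using chapman_kolmogorov[OF assms(5) K(2) that t(2), of "?t + u0"] assms(6) by simp
    moreover have "?t + u0 = s + real (Suc k) * u0"
      by (simp add: algebra_simps)
    ultimately show ?case by (simp only: power_Suc2)
  qed
  \<comment> \<open>The condition \<open>0 \<le> s\<close> is moved under the existential
    quantifiers so that choice gives functions on all of the reals.\<close>
  have "\<forall>k s. \<exists>\<Psi> A. 0 \<le> s \<longrightarrow> stochastic_matrix \<Psi> \<and> positive_matrix \<Psi> \<and>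
      identical_rows \<Psi> \<and> stochastic_matrix A \<and>
      P s (s + real k * u0) = (1 - (1 - \<delta>) ^ k) *\<^sub>R \<Psi> + (1 - \<delta>) ^ k *\<^sub>R A"
    using mixture unfolding row_mixture_def by blast
  then obtain \<Psi> A where "\<forall>k s. 0 \<le> s \<longrightarrow> stochastic_matrix (\<Psi> k s) \<and> positive_matrix (\<Psi> k s) \<and>
      identical_rows (\<Psi> k s) \<and> stochastic_matrix (A k s) \<and>
      P s (s + real k * u0) = (1 - (1 - \<delta>) ^ k) *\<^sub>R \<Psi> k s + (1 - \<delta>) ^ k *\<^sub>R A k s"
    by (metis (no_types))
  then show ?thesis
    using \<delta> by (intro exI[of _ \<delta>] conjI exI[of _ \<Psi>] exI[of _ A]) auto
qed

end
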